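(* Let $d = p_1^{\varepsilon_1}p_2^{\varepsilon_2}\cdots p_r^{\varepsilon_r}$, where $r\ge 1$, $p_1,\dots,p_r$ are distinct primes and $\varepsilon_1,\dots,\varepsilon_r\ge 1$ are integers. Let $G$ be the generalized Pauli group generated by the shift operator $X$ and the clock operator $Z$ on $\mathbb{C}^d$, and let $\omega^aX^bZ^c\in G$ with $a,b,c\in\mathbb{Z}_d$. Then the number of operators in $G$ which commute with $\omega^aX^bZ^c$ is equal to $$d\cdot|(b,c)^\perp| = d^2\cdot\prod_{k=1}^{r}p_k^{\delta_k},$$ where $(\delta_1,\dots,\delta_r)$ is the degree of $(b,c)\in\mathbb{Z}_d^2$.
   Context: $\mathbb{Z}_n$ denotes the ring of integers modulo $n$. Let $\{|s\rangle:s\in\mathbb{Z}_d\}$ be the standard (computational) basis of $\mathbb{C}^d$ and $\omega$ a fixed primitive $d$-th root of unity. The unitary operators $X,Z$ on $\mathbb{C}^d$ are defined by $X|s\rangle=|s+1\rangle$ and $Z|s\rangle=\omega^s|s\rangle$ for all $s\in\mathbb{Z}_d$ (addition modulo $d$). $G$ is the group generated by $X$ and $Z$; each element of $G$ can be written uniquely as $\omega^aX^bZ^c$ with $a,b,c\in\mathbb{Z}_d$. Perp-set: on $\mathbb{Z}_d^2$ let $[(b,c),(b',c')]:=cb'-c'b\in\mathbb{Z}_d$. Then $(b,c)^\perp:=\{(u,v)\in\mathbb{Z}_d^2:[(b,c),(u,v)]=0\}$. Degree: put $d_k:=p_k^{\varepsilon_k}$ and, for $x\in\mathbb{Z}_d$,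 let $x^{(k)}\in\mathbb{Z}_{d_k}$ be its reduction modulo $d_k$. For a prime power $p^{\varepsilon}$ (with $\varepsilon\ge1$), the degree of a vector $(b,c)\in\mathbb{Z}_{p^\varepsilon}^2$ is the largest $\kappa\in\{0,1,\dots,\varepsilon\}$ such that both $b$ and $c$ lie in the ideal $\mathbb{Z}_{p^\varepsilon}\cdot p^\kappa$ (in particular the zero vector has degree $\varepsilon$). For general $d$, the degree of $(b,c)\in\mathbb{Z}_d^2$ is the $r$-tuple $(\delta_1,\dots,\delta_r)$, where $\delta_k$ is the degree of $(b^{(k)},c^{(k)})\in\mathbb{Z}_{d_k}^2$. *)

theory Defs
  imports
    "HOL-Algebra.Generated_Groups"
    "HOL-Algebra.Ideal"
    "HOL-Number_Theory.Residues"
    "Jordan_Normal_Form.Matrix"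
begin

text \<open>The ring of integers modulo \<open>d\<close> is \<open>residue_ring (int d)\<close>: its elements are the
  integers \<open>0, \<dots>, d - 1\<close>.\<close>

abbreviation Zmod :: "nat \<Rightarrow> int ring" where
  "Zmod d \<equiv> residue_ring (int d)"

definition primitive_root_of_unity :: "nat \<Rightarrow> complex \<Rightarrow> bool" where
  "primitive_root_of_unity d \<omega> \<longleftrightarrow> d > 0 \<and> \<omega> ^ d = 1 \<and> (\<forall>j. 0 < j \<and> j < d \<longrightarrow> \<omega> ^ j \<noteq> 1)"

text \<open>Operators on \<open>\<complex>\<^sup>d\<close> are \<open>d \<times> d\<close> matrices over the standard basis \<open>unit_vec d s\<close>, \<open>s < d\<close>,
  so column \<open>s\<close> of a matrix is the image of the \<open>s\<close>-th basis vector.\<close>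

definition shift_op :: "nat \<Rightarrow> complex mat" where
  "shift_op d = mat_of_cols d (map (\<lambda>s. unit_vec d ((s + 1) mod d)) [0..<d])"

definition clock_op :: "nat \<Rightarrow> complex \<Rightarrow> complex mat" where
  "clock_op d \<omega> = mat_of_cols d (map (\<lambda>s. \<omega> ^ s \<cdot>\<^sub>v unit_vec d s) [0..<d])"

text \<open>The generated subgroup is taken inside the group of invertible \<open>d \<times> d\<close> matrices.\<close>

definition pauli_group :: "nat \<Rightarrow> complex \<Rightarrow> complex mat set" where
  "pauli_group d \<omega> = generate (units_of (ring_mat TYPE(complex) d ())) {shift_op d, clock_op d \<omega>}"

text \<open>The exponents are the representatives in \<open>{0..<d}\<close>; this is immaterial, as \<open>\<omega>\<close>, the shift
  and the clock all have order \<open>d\<close>.\<close>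

definition pauli_op :: "nat \<Rightarrow> complex \<Rightarrow> int \<Rightarrow> int \<Rightarrow> int \<Rightarrow> complex mat" where
  "pauli_op d \<omega> a b c = \<omega> ^ nat a \<cdot>\<^sub>m (shift_op d ^\<^sub>m nat b * clock_op d \<omega> ^\<^sub>m nat c)"

fun symp :: "nat \<Rightarrow> int \<times> int \<Rightarrow> int \<times> int \<Rightarrow> int" where
  "symp d (b, c) (b', c') =
     (c \<otimes>\<^bsub>Zmod d\<^esub> b') \<ominus>\<^bsub>Zmod d\<^esub> (c' \<otimes>\<^bsub>Zmod d\<^esub> b)"

definition perp :: "nat \<Rightarrow> int \<times> int \<Rightarrow> (int \<times> int) set" where
  "perp d v = {w \<in> carrier (Zmod d) \<times> carrier (Zmod d). symp d v w = \<zero>\<^bsub>Zmod d\<^esub>}"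

text \<open>The degree of a vector over the integers modulo \<open>p ^ e\<close>. The reduction modulo \<open>p ^ e\<close> of the
  generator matters for \<open>\<kappa> = e\<close>, where the ideal is zero.\<close>

definition pp_degree :: "nat \<Rightarrow> nat \<Rightarrow> int \<times> int \<Rightarrow> nat" where
  "pp_degree p e v = Max {\<kappa> \<in> {0..e}.
     fst v \<in> PIdl\<^bsub>Zmod (p ^ e)\<^esub> (int (p ^ \<kappa>) mod int (p ^ e)) \<and>
     snd v \<in> PIdl\<^bsub>Zmod (p ^ e)\<^esub> (int (p ^ \<kappa>) mod int (p ^ e))}"

text \<open>The degree of a vector modulo \<open>\<Prod>k=1..r. p k ^ \<epsilon> k\<close>, as a tuple indexed by \<open>{1..r}\<close>.\<close>

definition vec_degree :: "nat \<Rightarrow> (nat \<Rightarrow> nat) \<Rightarrow> (nat \<Rightarrow> nat) \<Rightarrow> int \<times> int \<Rightarrow> (nat \<Rightarrow> nat)" where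
  "vec_degree r p \<epsilon> v = (\<lambda>k\<in>{1..r}.
     pp_degree (p k) (\<epsilon> k) (fst v mod int (p k ^ \<epsilon> k), snd v mod int (p k ^ \<epsilon> k)))"

end

(* The operators P a b c = \<omega>^a X^b Z^c multiply by P a b c * P a' b' c' = P (a + a' + c b') (b + b') (c + c'),
   because Z X = \<omega> X Z. Hence they exhaust the group, and two of them commute iff c b' = c' b modulo d;
   the free factor \<omega>^a' accounts for the factor d. The perp-set is the kernel of the homomorphism
   (u, v) \<mapsto> c u - b v on pairs modulo d, whose image consists of the multiples of g = gcd(b, c, d)
   and has d / g elements, so the kernel has d g elements. By coprimality g is the product of the
   gcd(b, c, p_k^\<epsilon>_k) = p_k^\<delta>_k. *)
theory Submission
  imports Defs
begin

section \<open>Perp-sets as congruences modulo d\<close>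

lemma (in residues) minus_eq_zero_iff:
  "(x \<otimes> y) \<ominus> (z \<otimes> w) = \<zero> \<longleftrightarrow> [x * y = z * w] (mod m)"
  by (simp add: a_minus_def res_neg_eq res_add_eq res_mult_eq res_zero_eq
      mod_simps cong_iff_dvd_diff mod_eq_0_iff_dvd)

lemma perp_eq:
  assumes "d > 1"
  shows "perp d (b, c) = {w \<in> {0..<int d} \<times> {0..<int d}. [c * fst w = snd w * b] (mod int d)}"
proof -
  \<comment> \<open>The locale supplies the arithmetic of \<open>Zmod d\<close> and asks for a
    modulus above 1.\<close>
  interpret residues "int d" "Zmod d" using assms by unfold_locales auto
  show ?thesis by (auto simp: perp_def minus_eq_zero_iff res_carrier_eq)
qed

section \<open>Operators with integer exponents and their products\<close>

locale pauli =
  fixes d :: nat and \<omega> :: complex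
  assumes root: "primitive_root_of_unity d \<omega>" and d_gt_1: "d > 1"
begin

lemma nonzero: "\<omega> \<noteq> 0"
  using root by (auto simp: primitive_root_of_unity_def zero_power)

text \<open>Division with remainder brings every exponent into \<open>{0..<d}\<close>, and
  primitivity makes 0 the only exponent there with power 1.\<close>

lemma powi_cong_iff: "\<omega> powi x = \<omega> powi y \<longleftrightarrow> [x = y] (mod int d)"
proof -
  have red: "\<omega> powi z = \<omega> ^ nat (z mod int d)" for z
  proof -
    have "\<omega> powi z = \<omega> powi (int d * (z div int d) + z mod int d)" by simp
    also have "\<dots> = (\<omega> powi int d) powi (z div int d) * \<omega> powi (z mod int d)"
      using nonzero by (subst power_int_add) (simp_all add: power_int_mult)
    also have "\<dots> = \<omega> ^ nat (z mod int d)"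
      using root by (simp add: primitive_root_of_unity_def power_int_def)
    finally show ?thesis .
  qed
  have "[x = y] (mod int d)" if "\<omega> powi x = \<omega> powi y"
  proof -
    have "\<omega> powi (x - y) = 1" using that nonzero by (simp add: power_int_diff)
    hence "\<omega> ^ nat ((x - y) mod int d) = 1" using red by simp
    moreover have "nat ((x - y) mod int d) < d"
      using d_gt_1 by (simp add: nat_less_iff)
    ultimately have "nat ((x - y) mod int d) = 0"
      using root unfolding primitive_root_of_unity_def by (metis gr0I)
    moreover have "(x - y) mod int d \<ge> 0" using d_gt_1 by simp
    ultimately have "(x - y) mod int d = 0" by simp
    thus ?thesis by (simp add: cong_iff_dvd_diff mod_eq_0_iff_dvd)
  qed
  thus ?thesis using red by (metis cong_def)
qed

text \<open>The operator \<omega>^a X^b Z^c by its entries, with arbitrary integers as exponents: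
  negative ones describe inverses, and the product rule involves no reduction modulo d.\<close>

definition P :: "int \<Rightarrow> int \<Rightarrow> int \<Rightarrow> complex mat" where
  "P a b c = mat d d (\<lambda>(i, j). if [int i = int j + b] (mod int d)
     then \<omega> powi (a + c * int j) else 0)"

lemma P_carrier [simp]: "P a b c \<in> carrier_mat d d"
  by (simp add: P_def)

lemma P_dim [simp]: "dim_row (P a b c) = d" "dim_col (P a b c) = d"
  by (simp_all add: P_def)

lemma P_index:
  "i < d \<Longrightarrow> j < d \<Longrightarrow>
    P a b c $$ (i, j) = (if [int i = int j + b] (mod int d) then \<omega> powi (a + c * int j) else 0)"
  by (simp add: P_def)

text \<open>With \<open>index_unique\<close>: the rows represent each residue class exactly once, so
  every column of \<open>P a b c\<close> has exactly one nonzero entry.\<close>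

lemma ex_index: "\<exists>i<d. [int i = z] (mod int d)"
  using d_gt_1 by (intro exI[of _ "nat (z mod int d)"]) (auto simp: nat_less_iff cong_def)

lemma index_unique: "i < d \<Longrightarrow> j < d \<Longrightarrow> [int i = int j] (mod int d) \<longleftrightarrow> i = j"
  by (auto simp: cong_def)

text \<open>The position of the nonzero entry in a column determines b. Its value determines a + c j
  in column j, so column 0 gives a and column 1, present since d > 1, gives c.\<close>

lemma P_eq_iff:
  "P a b c = P a' b' c' \<longleftrightarrow>
    [a = a'] (mod int d) \<and> [b = b'] (mod int d) \<and> [c = c'] (mod int d)"
proof
  assume eq: "P a b c = P a' b' c'"
  have entry: "[b = b'] (mod int d) \<and> [a + c * int j = a' + c' * int j] (mod int d)"
    if j: "j < d" for j
  proof -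
    obtain i where i: "i < d" "[int i = int j + b] (mod int d)" using ex_index by blast
    have "P a b c $$ (i, j) = P a' b' c' $$ (i, j)" using eq by simp
    \<comment> \<open>The left entry is a power of \<omega>, hence nonzero, so the right one cannot
      be the default 0 of \<open>P\<close>.\<close>
    hence e: "[int i = int j + b'] (mod int d)" "\<omega> powi (a + c * int j) = \<omega> powi (a' + c' * int j)"
      using i j nonzero by (auto simp: P_index split: if_splits)
    from e(1) i(2) have "[int j + b = int j + b'] (mod int d)"
      by (metis cong_sym cong_trans)
    thus ?thesis using e(2) by (simp add: powi_cong_iff cong_add_lcancel)
  qed
  have "[a = a'] (mod int d)" using entry[of 0] d_gt_1 by simp
  moreover have "[a + c = a' + c'] (mod int d)" using entry[of 1] d_gt_1 by simp
  ultimately have "[(a + c) - a = (a' + c') - a'] (mod int d)" by (rule cong_diff[rotated])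
  with \<open>[a = a'] (mod int d)\<close> entry[of 0] d_gt_1
  show "[a = a'] (mod int d) \<and> [b = b'] (mod int d) \<and> [c = c'] (mod int d)" by simp
next
  assume *: "[a = a'] (mod int d) \<and> [b = b'] (mod int d) \<and> [c = c'] (mod int d)"
  hence "\<omega> powi (a + c * int j) = \<omega> powi (a' + c' * int j)" for j
    unfolding powi_cong_iff by (intro cong_add cong_mult) auto
  moreover have "[int i = int j + b] (mod int d) \<longleftrightarrow> [int i = int j + b'] (mod int d)" for i j
    using * by (metis cong_add_lcancel cong_sym cong_trans)
  ultimately show "P a b c = P a' b' c'" unfolding P_def by (intro cong_mat) simp_all
qed

text \<open>Column j of the right factor is nonzero only in the row k congruent to j + b', so the
  sum for each entry collapses to the term at k.\<close>

lemma P_mult: "P a b c * P a' b' c' = P (a + a' + c * b') (b + b') (c + c')"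
proof (rule eq_matI)
  fix i j assume "i < dim_row (P (a + a' + c * b') (b + b') (c + c'))"
    and "j < dim_col (P (a + a' + c * b') (b + b') (c + c'))"
  hence ij: "i < d" "j < d" by simp_all
  obtain k where k: "k < d" "[int k = int j + b'] (mod int d)" using ex_index by blast
  have other: "P a' b' c' $$ (l, j) = 0" if "l < d" "l \<noteq> k" for l
  proof -
    have "\<not> [int l = int j + b'] (mod int d)"
      using index_unique[OF that(1) k(1)] k(2) that(2) by (metis cong_sym cong_trans)
    thus ?thesis using that ij by (simp add: P_index)
  qed
  have "(P a b c * P a' b' c') $$ (i, j) = (\<Sum>l<d. P a b c $$ (i, l) * P a' b' c' $$ (l, j))"
    using ij by (simp add: scalar_prod_def atLeast0LessThan)
  also have "\<dots> = (\<Sum>l\<in>{k}. P a b c $$ (i, l) * P a' b' c' $$ (l, j))"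
    using k other by (intro sum.mono_neutral_right) auto
  also have "\<dots> = P a b c $$ (i, k) * \<omega> powi (a' + c' * int j)"
    using ij k by (simp add: P_index)
  also have "P a b c $$ (i, k)
      = (if [int i = int j + (b + b')] (mod int d) then \<omega> powi (a + c * (int j + b')) else 0)"
  proof -
    have "[int k + b = int j + (b + b')] (mod int d)"
      using cong_add[OF k(2) cong_refl[of b]] by (simp add: ac_simps)
    hence "[int i = int k + b] (mod int d) \<longleftrightarrow> [int i = int j + (b + b')] (mod int d)"
      by (metis cong_sym cong_trans)
    \<comment> \<open>Substituting \<open>int j + b'\<close> for \<open>int k\<close> in the
      exponent is the source of the phase \<open>c * b'\<close>.\<close>
    moreover have "\<omega> powi (a + c * int k) = \<omega> powi (a + c * (int j + b'))"
      unfolding powi_cong_iff using k(2) by (intro cong_add cong_mult) auto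
    ultimately show ?thesis using ij k by (simp add: P_index)
  qed
  also have "\<dots> * \<omega> powi (a' + c' * int j) = P (a + a' + c * b') (b + b') (c + c') $$ (i, j)"
    using ij nonzero by (simp add: P_index power_int_add[symmetric] algebra_simps)
  finally show "(P a b c * P a' b' c') $$ (i, j) = P (a + a' + c * b') (b + b') (c + c') $$ (i, j)" .
qed simp_all

text \<open>The two products share the exponents of shift and clock; only the phases
  \<open>c * b'\<close> and \<open>c' * b\<close> can differ.\<close>

lemma P_commute_iff:
  "P a b c * P a' b' c' = P a' b' c' * P a b c \<longleftrightarrow> [c * b' = c' * b] (mod int d)"
  by (simp add: P_mult P_eq_iff ac_simps cong_add_lcancel)

lemma P_one: "P 0 0 0 = 1\<^sub>m d"
  by (rule eq_matI) (auto simp: P_index index_unique)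

lemma shift_op_eq: "shift_op d = P 0 1 0"
proof (rule eq_matI)
  fix i j assume "i < dim_row (P 0 1 0)" and "j < dim_col (P 0 1 0)"
  hence ij: "i < d" "j < d" by simp_all
  hence "i = (j + 1) mod d \<longleftrightarrow> [i = j + 1] (mod d)"
    by (simp add: cong_def)
  also have "\<dots> \<longleftrightarrow> [int i = int j + 1] (mod int d)"
    using cong_int_iff[of i "j + 1" d] by (simp add: add.commute)
  finally have "i = (j + 1) mod d \<longleftrightarrow> [int i = int j + 1] (mod int d)" .
  thus "shift_op d $$ (i, j) = P 0 1 0 $$ (i, j)"
    using ij by (simp add: shift_op_def P_index mat_of_cols_index)
qed (simp_all add: shift_op_def)

lemma clock_op_eq: "clock_op d \<omega> = P 0 0 1"
  by (rule eq_matI) (auto simp: clock_op_def P_index mat_of_cols_index index_unique power_int_def)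

lemma smult_P: "\<omega> ^ n \<cdot>\<^sub>m P a b c = P (int n + a) b c"
proof -
  have "\<omega> ^ n * \<omega> powi x = \<omega> powi (int n + x)" for x
    using nonzero by (simp add: power_int_add)
  thus ?thesis by (intro eq_matI) (auto simp: P_index add.assoc)
qed

lemma P_power: "P 0 b 0 ^\<^sub>m n = P 0 (int n * b) 0" "P 0 0 c ^\<^sub>m n = P 0 0 (int n * c)"
  "P a 0 0 ^\<^sub>m n = P (int n * a) 0 0"
  by (induction n) (simp_all add: P_one P_mult algebra_simps)

lemma pauli_op_eq:
  assumes "a \<ge> 0" "b \<ge> 0" "c \<ge> 0"
  shows "pauli_op d \<omega> a b c = P a b c"
  using assms by (simp add: pauli_op_def shift_op_eq clock_op_eq P_power P_mult smult_P)

section \<open>The Pauli group and the commutant of an element\<close>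

abbreviation GL :: "complex mat monoid" where
  "GL \<equiv> units_of (ring_mat TYPE(complex) d ())"

text \<open>The phase \<open>c * b - a\<close> of the inverse cancels a together with the phase
  \<open>- c * b\<close> that either product creates.\<close>

lemma P_Units: "P a b c \<in> carrier GL"
proof -
  have "P a b c * P (c * b - a) (- b) (- c) = 1\<^sub>m d" "P (c * b - a) (- b) (- c) * P a b c = 1\<^sub>m d"
    by (simp_all add: P_mult P_one[symmetric] mult.commute)
  thus ?thesis by (auto simp: units_of_def Units_def ring_mat_def)
qed

lemma group_GL: "group GL"
  by (intro monoid.units_group ring.is_monoid ring_mat)

lemma GL_simps: "x \<otimes>\<^bsub>GL\<^esub> y = x * y" "\<one>\<^bsub>GL\<^esub> = 1\<^sub>m d"
  by (simp_all add: units_of_def ring_mat_def)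

lemma P_inv: "inv\<^bsub>GL\<^esub> P a b c = P (c * b - a) (- b) (- c)"
  by (rule group.inv_equality[OF group_GL])
    (simp_all add: P_Units GL_simps P_mult P_one[symmetric] mult.commute)

text \<open>The matrices \<open>P a b c\<close> include the generators and their inverses and are
  closed under products. Conversely, each is a product of powers of \<omega>, the shift and the
  clock, where the scalar \<omega> is a commutator of the generators.\<close>

lemma pauli_group_eq: "pauli_group d \<omega> = {P a b c | a b c. True}"
proof (intro equalityI subsetI)
  fix T assume "T \<in> pauli_group d \<omega>"
  hence "T \<in> generate GL {P 0 1 0, P 0 0 1}"
    by (simp add: pauli_group_def shift_op_eq clock_op_eq)
  thus "T \<in> {P a b c | a b c. True}"
  proof (induction rule: generate.induct)
    case one
    show ?case by (auto simp: GL_simps P_one[symmetric])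
  next
    case (incl h) thus ?case by auto
  next
    case (inv h)
    hence "inv\<^bsub>GL\<^esub> h \<in> {P 0 (- 1) 0, P 0 0 (- 1)}" by (auto simp: P_inv)
    thus ?case by blast
  next
    case (eng h1 h2)
    then obtain a b c a' b' c' where "h1 = P a b c" "h2 = P a' b' c'" by blast
    hence "h1 \<otimes>\<^bsub>GL\<^esub> h2 = P (a + a' + c * b') (b + b') (c + c')"
      by (simp only: GL_simps P_mult)
    thus ?case by blast
  qed
next
  fix T assume "T \<in> {P a b c | a b c. True}"
  then obtain a b c where T: "T = P a b c" by auto
  let ?G = "generate GL {P 0 1 0, P 0 0 1}"
  have mult: "x * y \<in> ?G" if "x \<in> ?G" "y \<in> ?G" for x y
    using generate.eng[OF that] by (simp add: GL_simps)
  \<comment> \<open>Membership in \<open>carrier_mat d d\<close> makes the zeroth power the identity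
    of size d.\<close>
  have pow: "x ^\<^sub>m n \<in> ?G" if "x \<in> ?G" "x \<in> carrier_mat d d" for x n
  proof (induction n)
    case 0 thus ?case using that generate.one[of GL] by (simp add: GL_simps)
  next
    case (Suc n) thus ?case using that mult by simp
  qed
  have X: "P 0 1 0 \<in> ?G" and Z: "P 0 0 1 \<in> ?G" by (auto intro: generate.incl)
  have "inv\<^bsub>GL\<^esub> P 0 1 0 \<in> ?G" and "inv\<^bsub>GL\<^esub> P 0 0 1 \<in> ?G" by (auto intro: generate.inv)
  \<comment> \<open>The commutator Z X Z^-1 X^-1 equals the scalar \<omega>, which is
    \<open>P 1 0 0\<close>.\<close>
  hence "(P 0 0 1 * P 0 1 0) * (P 0 0 (-1) * P 0 (-1) 0) \<in> ?G"
    using X Z by (intro mult) (simp_all add: P_inv)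
  hence W: "P 1 0 0 \<in> ?G" by (simp add: P_mult)
  \<comment> \<open>Matrix powers need natural exponents; residues suffice because \<open>P\<close>
    depends on its arguments only modulo d.\<close>
  define a' b' c' where "a' = nat (a mod int d)" "b' = nat (b mod int d)" "c' = nat (c mod int d)"
  have "P 1 0 0 ^\<^sub>m a' * (P 0 1 0 ^\<^sub>m b' * P 0 0 1 ^\<^sub>m c') \<in> ?G"
    by (intro mult pow X Z W) simp_all
  also have "P 1 0 0 ^\<^sub>m a' * (P 0 1 0 ^\<^sub>m b' * P 0 0 1 ^\<^sub>m c') = T"
    using d_gt_1 by (simp add: P_power P_mult T P_eq_iff a'_b'_c'_def cong_def)
  finally show "T \<in> pauli_group d \<omega>"
    by (simp add: pauli_group_def shift_op_eq clock_op_eq)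
qed

text \<open>By \<open>P_eq_iff\<close>, reduced exponents parametrise the group without repetition;
  commuting constrains the last two to the perp-set and leaves the first free.\<close>

lemma card_commutant:
  "card {T \<in> pauli_group d \<omega>. T * P a b c = P a b c * T} = d * card (perp d (b, c))"
proof -
  let ?f = "\<lambda>(x, u, v). P x u v"
  have "inj_on ?f ({0..<int d} \<times> perp d (b, c))"
    by (auto simp: inj_on_def P_eq_iff perp_eq[OF d_gt_1] cong_def)
  moreover have "?f ` ({0..<int d} \<times> perp d (b, c))
      = {T \<in> pauli_group d \<omega>. T * P a b c = P a b c * T}"
  proof (intro equalityI subsetI)
    fix T assume "T \<in> {T \<in> pauli_group d \<omega>. T * P a b c = P a b c * T}"
    then obtain x u v where T: "T = P x u v" and "P a b c * P x u v = P x u v * P a b c"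
      by (auto simp: pauli_group_eq)
    hence "[c * u = v * b] (mod int d)" by (simp add: P_commute_iff)
    \<comment> \<open>Reducing the exponents keeps T and moves the triple into the finite index
      set.\<close>
    hence "(u mod int d, v mod int d) \<in> perp d (b, c)"
      using d_gt_1 by (simp add: perp_eq[OF d_gt_1] cong_def mod_simps)
    moreover have "T = P (x mod int d) (u mod int d) (v mod int d)"
      by (simp add: T P_eq_iff cong_def)
    ultimately show "T \<in> ?f ` ({0..<int d} \<times> perp d (b, c))"
      using d_gt_1 by (intro image_eqI[of _ _ "(x mod int d, u mod int d, v mod int d)"]) simp_all
  next
    fix T assume "T \<in> ?f ` ({0..<int d} \<times> perp d (b, c))"
    then obtain x u v where "T = P x u v" "(u, v) \<in> perp d (b, c)" by auto
    moreover from this have "P a b c * P x u v = P x u v * P a b c"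
      by (simp add: P_commute_iff perp_eq[OF d_gt_1])
    ultimately show "T \<in> {T \<in> pauli_group d \<omega>. T * P a b c = P a b c * T}"
      by (auto simp: pauli_group_eq)
  qed
  ultimately have "bij_betw ?f ({0..<int d} \<times> perp d (b, c))
      {T \<in> pauli_group d \<omega>. T * P a b c = P a b c * T}"
    unfolding bij_betw_def by (rule conjI)
  hence "card {T \<in> pauli_group d \<omega>. T * P a b c = P a b c * T}
      = card ({0..<int d} \<times> perp d (b, c))"
    by (rule bij_betw_same_card[symmetric])
  thus ?thesis by (simp add: card_cartesian_product)
qed

end

section \<open>Size of the kernel of the symplectic form\<close>

text \<open>The fibres of \<open>f\<close> over its image are translates of the kernel
  \<open>K\<close>, and the image consists of the n / g reduced multiples of g. Counting
  \<open>S\<close> by fibres gives n^2 = (n / g) |K|.\<close>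

lemma card_symp_kernel:
  fixes b c n :: int
  assumes n: "n > 0"
  shows "int (card {w \<in> {0..<n} \<times> {0..<n}. [c * fst w = snd w * b] (mod n)})
    = n * gcd (gcd c b) n"
proof -
  define S where "S = {0..<n} \<times> {0..<n}"
  define f where "f = (\<lambda>w. (c * fst w - b * snd w) mod n)"
  define g where "g = gcd (gcd c b) n"
  define K where "K = {w \<in> S. f w = 0}"
  have g: "g > 0" "g dvd n" "g dvd c" "g dvd b"
    using n gcd_dvd1[of "gcd c b" n] by (auto simp: g_def intro: dvd_trans)
  have fin: "finite S" by (simp add: S_def)
  have K: "{w \<in> {0..<n} \<times> {0..<n}. [c * fst w = snd w * b] (mod n)} = K"
    by (auto simp: K_def S_def f_def cong_iff_dvd_diff mod_eq_0_iff_dvd mult.commute)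
  have "f ` S = (\<lambda>m. g * m) ` {0..<n div g}"
  proof (intro equalityI subsetI)
    fix t assume "t \<in> f ` S"
    then obtain w where t: "t = f w" by auto
    have "g dvd t" unfolding t f_def using g by (simp add: dvd_mod)
    then obtain m where m: "t = g * m" ..
    have "0 \<le> t" "t < n" using n by (auto simp: t f_def)
    hence "m \<in> {0..<n div g}"
      using m g by (auto simp: zero_le_mult_iff elim!: dvdE)
    thus "t \<in> (\<lambda>m. g * m) ` {0..<n div g}" using m by blast
  next
    fix t assume "t \<in> (\<lambda>m. g * m) ` {0..<n div g}"
    then obtain m where m: "t = g * m" "0 \<le> m" "m < n div g" by (meson atLeastLessThan_iff imageE)
    have t: "0 \<le> t" "t < n" using m g by (auto elim!: dvdE)
    \<comment> \<open>Two Bezout identities express g through c, b and n. Scaling by m yields a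
      preimage of t; its second coordinate changes sign because \<open>f\<close> subtracts the
      b-term.\<close>
    obtain s r where sr: "s * gcd c b + r * n = g" using bezout_int g_def by blast
    obtain x y where xy: "x * c + y * b = gcd c b" using bezout_int by blast
    have "t = m * (s * (x * c + y * b) + r * n)" using m sr xy by simp
    hence "t = c * (m * s * x) - b * (- (m * s * y)) + n * (m * r)" by (simp add: algebra_simps)
    hence "t = f (m * s * x mod n, - (m * s * y) mod n)"
      using t unfolding f_def fst_conv snd_conv
      by (metis mod_pos_pos_trivial mod_mult_self2 mod_diff_eq mod_mult_right_eq)
    moreover have "(m * s * x mod n, - (m * s * y) mod n) \<in> S" using n by (simp add: S_def)
    ultimately show "t \<in> f ` S" by blast
  qed
  moreover have "inj_on (\<lambda>m. g * m) {0..<n div g}" using g by (simp add: inj_on_def)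
  ultimately have card_image: "card (f ` S) = nat (n div g)"
    by (simp add: card_image)
  have fibre: "card {w \<in> S. f w = t} = card K" if tS: "t \<in> f ` S" for t
  proof -
    obtain w where "t = f w" using tS by blast
    then obtain u v where uv: "t = f (u, v)" by (cases w) auto
    have f_mod: "f (x mod n, y mod n) = f (x, y)" for x y
      unfolding f_def fst_conv snd_conv by (metis mod_diff_eq mod_mult_right_eq)
    have fadd: "f ((x + u) mod n, (y + v) mod n) = (f (x, y) + f (u, v)) mod n" for x y
    proof -
      have "f (x + u, y + v) = ((c * x - b * y) + (c * u - b * v)) mod n"
        unfolding f_def fst_conv snd_conv by (rule arg_cong[of _ _ "\<lambda>z. z mod n"])
          (simp add: algebra_simps)
      thus ?thesis unfolding f_mod by (simp add: f_def mod_add_eq)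
    qed
    have fdiff: "f ((x - u) mod n, (y - v) mod n) = (f (x, y) - f (u, v)) mod n" for x y
    proof -
      have "f (x - u, y - v) = ((c * x - b * y) - (c * u - b * v)) mod n"
        unfolding f_def fst_conv snd_conv by (rule arg_cong[of _ _ "\<lambda>z. z mod n"])
          (simp add: algebra_simps)
      thus ?thesis unfolding f_mod by (simp add: f_def mod_diff_eq)
    qed
    let ?add = "\<lambda>w. ((fst w + u) mod n, (snd w + v) mod n)"
    let ?sub = "\<lambda>w. ((fst w - u) mod n, (snd w - v) mod n)"
    have t: "t mod n = t" by (simp add: uv f_def)
    \<comment> \<open>Translation by the chosen point (u, v) of the fibre carries the kernel onto
      that fibre, with the opposite translation as inverse.\<close>
    have "bij_betw ?add K {w \<in> S. f w = t}"
    proof (rule bij_betw_byWitness[where f' = ?sub])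
      show "\<forall>w\<in>K. ?sub (?add w) = w" "\<forall>w\<in>{w \<in> S. f w = t}. ?add (?sub w) = w"
        by (auto simp: K_def S_def mod_simps)
      show "?add ` K \<subseteq> {w \<in> S. f w = t}"
      proof (rule image_subsetI)
        fix w assume "w \<in> K"
        hence "f w = 0" by (simp add: K_def)
        hence "f (?add w) = t" using fadd[of "fst w" "snd w"] t uv by simp
        moreover have "?add w \<in> S" using n by (simp add: S_def)
        ultimately show "?add w \<in> {w \<in> S. f w = t}" by blast
      qed
      show "?sub ` {w \<in> S. f w = t} \<subseteq> K"
      proof (rule image_subsetI)
        fix w assume "w \<in> {w \<in> S. f w = t}"
        hence "f w = t" by blast
        hence "f (?sub w) = 0" using fdiff[of "fst w" "snd w"] uv by simp
        moreover have "?sub w \<in> S" using n by (simp add: S_def)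
        ultimately show "?sub w \<in> K" by (simp add: K_def)
      qed
    qed
    thus ?thesis by (simp add: bij_betw_same_card)
  qed
  have "card S = (\<Sum>t\<in>f ` S. card {w \<in> S. f w = t})"
    using sum.image_gen[OF fin, of "\<lambda>_. 1 :: nat" f] by simp
  also have "\<dots> = nat (n div g) * card K" using fibre card_image by simp
  finally have "int (card S) = (n div g) * int (card K)"
    using n g by (simp add: pos_imp_zdiv_nonneg_iff)
  moreover have "int (card S) = n * n" using n by (simp add: S_def card_cartesian_product)
  \<comment> \<open>Writing n = g q replaces the quotient by q, which is nonzero and
    cancels.\<close>
  moreover obtain q where "n = g * q" using g by blast
  ultimately have "g * q * (g * q) = q * int (card K)" using g by simp
  hence "int (card K) = n * g" using n \<open>n = g * q\<close> by (auto simp: ac_simps)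
  thus ?thesis by (simp add: K g_def)
qed

lemma card_perp:
  assumes "d > 1"
  shows "int (card (perp d (b, c))) = int d * gcd (gcd c b) (int d)"
  using card_symp_kernel[of "int d" c b] assms by (simp add: perp_eq)

section \<open>The degree as the exponent of a gcd\<close>

text \<open>Since m divides n, reduction modulo n preserves divisibility by m. Reducing the
  generator also covers m = n, where the ideal is zero.\<close>

lemma PIdl_Zmod_iff:
  assumes "0 \<le> x" "x < int n" "m dvd int n"
  shows "x \<in> PIdl\<^bsub>Zmod n\<^esub> (m mod int n) \<longleftrightarrow> m dvd x"
proof
  assume "x \<in> PIdl\<^bsub>Zmod n\<^esub> (m mod int n)"
  then obtain y where "x = y * (m mod int n) mod int n"
    by (auto simp: cgenideal_def residue_ring_def)
  thus "m dvd x" using assms(3) by (simp add: dvd_mod mod_simps)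
next
  assume "m dvd x"
  then obtain y where "x = m * y" ..
  hence "x = (y mod int n) * (m mod int n) mod int n"
    using assms by (simp add: mod_simps mult.commute)
  moreover have "y mod int n \<in> carrier (Zmod n)"
    using assms by (simp add: residue_ring_def)
  ultimately show "x \<in> PIdl\<^bsub>Zmod n\<^esub> (m mod int n)"
    by (auto simp: cgenideal_def residue_ring_def)
qed

text \<open>The gcd divides p^e, so it is some p^i with i at most e. An exponent k up to e satisfies
  the ideal conditions exactly when p^k divides this gcd, that is when k is at most i, so the
  maximum is i.\<close>

lemma power_pp_degree:
  assumes p: "prime p"
  shows "int (p ^ pp_degree p e (b mod int (p ^ e), c mod int (p ^ e)))
    = gcd (gcd c b) (int (p ^ e))"
proof -
  let ?n = "int (p ^ e)"
  have n: "?n > 0" using p by (simp add: prime_gt_0_nat)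
  obtain i where i: "i \<le> e" "nat (gcd (gcd c b) ?n) = p ^ i"
    using divides_primepow_nat[OF p, of "nat (gcd (gcd c b) ?n)" e]
    by (metis gcd_dvd2 gcd_ge_0_int nat_dvd_iff)
  hence gi: "gcd (gcd c b) ?n = int (p ^ i)"
    by (metis gcd_ge_0_int int_nat_eq)
  have *: "(b mod ?n \<in> PIdl\<^bsub>Zmod (p ^ e)\<^esub> (int (p ^ k) mod ?n) \<and>
      c mod ?n \<in> PIdl\<^bsub>Zmod (p ^ e)\<^esub> (int (p ^ k) mod ?n)) \<longleftrightarrow> k \<le> i" if "k \<le> e" for k
  proof -
    have dvd: "int (p ^ k) dvd ?n" using that by (simp add: le_imp_power_dvd)
    have "(b mod ?n \<in> PIdl\<^bsub>Zmod (p ^ e)\<^esub> (int (p ^ k) mod ?n) \<and>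
        c mod ?n \<in> PIdl\<^bsub>Zmod (p ^ e)\<^esub> (int (p ^ k) mod ?n))
        \<longleftrightarrow> int (p ^ k) dvd b \<and> int (p ^ k) dvd c"
      using n dvd
      by (metis PIdl_Zmod_iff dvd_mod_iff pos_mod_bound pos_mod_sign)
    also have "\<dots> \<longleftrightarrow> int (p ^ k) dvd int (p ^ i)"
      using dvd by (simp add: gi[symmetric] del: of_nat_power) blast
    also have "\<dots> \<longleftrightarrow> k \<le> i"
      unfolding of_nat_dvd_iff using p prime_gt_1_nat power_dvd_imp_le le_imp_power_dvd by blast
    finally show ?thesis .
  qed
  have "{\<kappa> \<in> {0..e}. b mod ?n \<in> PIdl\<^bsub>Zmod (p ^ e)\<^esub> (int (p ^ \<kappa>) mod ?n) \<and>
      c mod ?n \<in> PIdl\<^bsub>Zmod (p ^ e)\<^esub> (int (p ^ \<kappa>) mod ?n)} = {\<kappa> \<in> {0..e}. \<kappa> \<le> i}"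
    using * by (intro Collect_cong conj_cong refl) (simp only: atLeastAtMost_iff)
  also have "\<dots> = {..i}" using i(1) by auto
  finally have "pp_degree p e (b mod ?n, c mod ?n) = i"
    unfolding pp_degree_def fst_conv snd_conv by (simp only:) (rule Max_eqI, simp_all)
  thus ?thesis using gi by simp
qed

section \<open>Multiplicativity of the gcd over coprime factors\<close>

text \<open>A divisor of x y splits into a divisor of x and one of y, which gives one divisibility.
  For the other, the product of the two gcds divides m because they are coprime, and divides x y
  factor by factor.\<close>

lemma gcd_mult_eq_mult_gcd:
  fixes m :: "'a :: semiring_gcd_mult_normalize"
  assumes "coprime x y"
  shows "gcd m (x * y) = gcd m x * gcd m y"
proof (rule associated_eqI)
  obtain x' y' where "gcd m (x * y) = x' * y'" "x' dvd x" "y' dvd y"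
    using division_decomp[of "gcd m (x * y)" x y] by auto
  moreover from this have "x' dvd m" "y' dvd m"
    by (metis dvd_mult_left dvd_mult_right gcd_dvd1)+
  ultimately show "gcd m (x * y) dvd gcd m x * gcd m y"
    by (simp add: mult_dvd_mono)
  have "coprime (gcd m x) (gcd m y)"
    using assms by (rule coprime_divisors[rotated 2]) auto
  thus "gcd m x * gcd m y dvd gcd m (x * y)"
    by (auto intro: divides_mult mult_dvd_mono)
qed (simp_all add: normalize_mult)

lemma gcd_prod_coprime:
  fixes m :: "'a :: semiring_gcd_mult_normalize"
  assumes "finite I" "\<And>i j. i \<in> I \<Longrightarrow> j \<in> I \<Longrightarrow> i \<noteq> j \<Longrightarrow> coprime (f i) (f j)"
  shows "gcd m (\<Prod>i\<in>I. f i) = (\<Prod>i\<in>I. gcd m (f i))"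
  using assms
proof (induction I rule: finite_induct)
  case (insert i I)
  have "coprime (f i) (\<Prod>j\<in>I. f j)"
    using insert by (intro prod_coprime_right) auto
  hence "gcd m (f i * (\<Prod>j\<in>I. f j)) = gcd m (f i) * gcd m (\<Prod>j\<in>I. f j)"
    by (rule gcd_mult_eq_mult_gcd)
  thus ?case using insert by auto
qed auto

section \<open>The commutant count in terms of the degree\<close>

theorem corollary1:
  fixes r d :: nat and p \<epsilon> \<delta> :: "nat \<Rightarrow> nat" and \<omega> :: complex and a b c :: int
  assumes "r \<ge> 1"
    and "\<And>k. k \<in> {1..r} \<Longrightarrow> prime (p k)"
    and "inj_on p {1..r}"
    and "\<And>k. k \<in> {1..r} \<Longrightarrow> \<epsilon> k \<ge> 1"
    and "d = (\<Prod>k=1..r. p k ^ \<epsilon> k)"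
    and "primitive_root_of_unity d \<omega>"
    and "a \<in> carrier (Zmod d)" and "b \<in> carrier (Zmod d)" and "c \<in> carrier (Zmod d)"
    and "pauli_op d \<omega> a b c \<in> pauli_group d \<omega>"
    and "\<delta> = vec_degree r p \<epsilon> (b, c)"
  shows "card {T \<in> pauli_group d \<omega>. T * pauli_op d \<omega> a b c = pauli_op d \<omega> a b c * T}
           = d * card (perp d (b, c))
       \<and> d * card (perp d (b, c)) = d\<^sup>2 * (\<Prod>k=1..r. p k ^ \<delta> k)"
proof -
  have coprime: "coprime (int (p i ^ \<epsilon> i)) (int (p j ^ \<epsilon> j))"
    if "i \<in> {1..r}" "j \<in> {1..r}" "i \<noteq> j" for i j
  proof -
    have "p i \<noteq> p j" using assms(3) that by (auto dest: inj_onD)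
    hence "coprime (p i) (p j)" using assms(2) that by (intro primes_coprime) auto
    thus ?thesis by simp
  qed
  \<comment> \<open>One nontrivial prime power factor, present because r is at least 1, forces d > 1
    as the locale \<open>pauli\<close> demands.\<close>
  have "p 1 ^ \<epsilon> 1 dvd d" unfolding assms(5) using assms(1) by (intro dvd_prodI) auto
  moreover have "1 < p 1 ^ \<epsilon> 1"
    using assms(1) assms(2)[of 1] assms(4)[of 1] by (intro one_less_power prime_gt_1_nat) auto
  moreover have "d > 0" using assms(6) by (simp add: primitive_root_of_unity_def)
  ultimately have d: "d > 1" by (meson dvd_imp_le less_le_trans)
  interpret pauli d \<omega> using assms(6) d by unfold_locales
  have "pauli_op d \<omega> a b c = P a b c"
    using assms(7-9) by (intro pauli_op_eq) (simp_all add: residue_ring_def)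
  hence commutant: "card {T \<in> pauli_group d \<omega>. T * pauli_op d \<omega> a b c = pauli_op d \<omega> a b c * T}
      = d * card (perp d (b, c))"
    using card_commutant by simp
  \<comment> \<open>Distinct primes make the factors of d pairwise coprime, so the gcd from the
    kernel count splits into local gcds, each given by the degree at its prime.\<close>
  have "gcd (gcd c b) (int d) = (\<Prod>k=1..r. gcd (gcd c b) (int (p k ^ \<epsilon> k)))"
    unfolding assms(5) of_nat_prod using coprime by (intro gcd_prod_coprime) auto
  also have "\<dots> = (\<Prod>k=1..r. int (p k ^ \<delta> k))"
    using assms(2) by (intro prod.cong refl) (simp only: power_pp_degree[symmetric]
      assms(11) vec_degree_def restrict_apply if_True fst_conv snd_conv)
  finally have "int (card (perp d (b, c))) = int (d * (\<Prod>k=1..r. p k ^ \<delta> k))"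
    using card_perp[OF d] by simp
  hence "card (perp d (b, c)) = d * (\<Prod>k=1..r. p k ^ \<delta> k)" by (simp only: of_nat_eq_iff)
  thus ?thesis using commutant by (simp add: power2_eq_square)
qed

end
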